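(* Let $n\ge 2$ be an integer, let $q\neq 0,1$ be a complex number, and let $t$ be a complex number. For the matrix $Q=[q^{j+k}+t]_{0\le j,k\le n-1}$, we have $$\det(xI_n-Q)=x^n-\left(nt+[n]_{q^2}\right)x^{n-1}+\left(n[n]_{q^2}-[n]_q^2\right)t\,x^{n-2}.$$
   Context: $I_n$ is the $n\times n$ identity matrix, and $\det(xI_n-Q)$ is the characteristic polynomial of $Q$ in the variable $x$. For an integer $m$ and a complex number $r\neq 0,1$, $[m]_r=\frac{r^m-1}{r-1}$, and $[m]_1=m$ (the limit as $r\to1$; needed for $[n]_{q^2}$ when $q=-1$). $[n]_q^2$ means $([n]_q)^2$. *)

theory Defs
  imports Complex_Main "Jordan_Normal_Form.Char_Poly"
begin

(* The intended domain is r \<noteq> 0; the value at r = 1 is the limit of the quotient as r tends to 1. *)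
definition qint :: "int \<Rightarrow> complex \<Rightarrow> complex" where
  "qint m r = (if r = 1 then of_int m else (r powi m - 1) / (r - 1))"

end

theory Submission
  imports Defs
begin

text \<open>
  The matrix \<open>Q\<close> has rank at most two: with \<open>u = (q\<^sup>0, \<dots>, q\<^sup>n\<^sup>-\<^sup>1)\<close> and the all-ones vector
  \<open>e\<close>, it is the sum of the outer product of \<open>u\<close> with itself and \<open>t\<close> times the outer product of
  \<open>e\<close> with itself. So \<open>Q = U V\<close>, where \<open>U\<close> is the \<open>n \<times> 2\<close> matrix with columns \<open>u\<close>, \<open>e\<close> and \<open>V\<close> is
  the \<open>2 \<times> n\<close> matrix with rows \<open>u\<close>, \<open>t e\<close>.

  Swapping the factors changes the characteristic polynomial only by a power of \<open>x\<close>
  (\<open>char_poly_mult_commute\<close>, Sylvester's identity):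
  \<open>x\<^sup>2 det(x I - U V) = x\<^sup>n det(x I - V U)\<close>. The matrix \<open>V U\<close> is \<open>2 \<times> 2\<close>, and its entries are
  scalar products of \<open>u\<close> and \<open>e\<close>, which are geometric sums:
  \<open>u \<bullet> u\<close> is \<open>[n]\<close> at the base \<open>q\<^sup>2\<close>, \<open>u \<bullet> e\<close> is \<open>[n]\<close> at the base \<open>q\<close>, and \<open>e \<bullet> e = n\<close>. The
  negated trace and the determinant of \<open>V U\<close> are the two lower coefficients, and cancelling
  \<open>x\<^sup>2\<close> gives the formula.
\<close>

lemma char_poly_four_block_lower_triangular:
  fixes A :: "'a :: idom mat"
  assumes A: "A \<in> carrier_mat m m" and C: "C \<in> carrier_mat n m" and D: "D \<in> carrier_mat n n"
  shows "char_poly (four_block_mat A (0\<^sub>m m n) C D) = char_poly A * char_poly D"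
proof -
  let ?N = "map_mat (\<lambda>a. [:- a:])"
  have "char_poly_matrix (four_block_mat A (0\<^sub>m m n) C D) =
      four_block_mat (char_poly_matrix A) (0\<^sub>m m n) (?N C) (char_poly_matrix D)"
    using assms by (intro eq_matI) (auto simp: char_poly_matrix_def)
  then show ?thesis
    unfolding char_poly_def
    using assms by (simp add: det_four_block_mat_upper_right_zero[of _ m _ n])
qed

lemma char_poly_zero_mat: "char_poly (0\<^sub>m n n :: 'a :: idom mat) = monom 1 n"
proof -
  have "diag_mat (0\<^sub>m n n :: 'a mat) = replicate n 0"
    by (auto simp: diag_mat_def intro!: nth_equalityI)
  moreover have "upper_triangular (0\<^sub>m n n :: 'a mat)" by auto
  ultimately show ?thesis
    using char_poly_upper_triangular[of "0\<^sub>m n n :: 'a mat" n]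
    by (simp add: monom_altdef)
qed

text \<open>
  Bordering by zero blocks turns the rectangular situation into a square one: the two
  \<open>(n + m)\<close>-dimensional block matrices \<open>L\<close> and \<open>R\<close> below are lower triangular with diagonal blocks
  \<open>A B, 0\<close> and \<open>0, B A\<close>, and the block shear \<open>P\<close> conjugates one to the other because
  \<open>P R = L P\<close>.
\<close>

lemma char_poly_mult_commute:
  fixes A :: "'a :: idom mat"
  assumes A: "A \<in> carrier_mat n m" and B: "B \<in> carrier_mat m n"
  shows "char_poly (A * B) * monom 1 m = monom 1 n * char_poly (B * A)"
proof -
  let ?P = "four_block_mat (1\<^sub>m n) A (0\<^sub>m m n) (1\<^sub>m m)"
  let ?Q = "four_block_mat (1\<^sub>m n) (- A) (0\<^sub>m m n) (1\<^sub>m m)"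
  let ?L = "four_block_mat (A * B) (0\<^sub>m n m) B (0\<^sub>m m m)"
  let ?R = "four_block_mat (0\<^sub>m n n) (0\<^sub>m n m) B (B * A)"
  have nA: "- A \<in> carrier_mat n m" using A by simp
  have AB: "A * B \<in> carrier_mat n n" and BA: "B * A \<in> carrier_mat m m"
    using A B by auto
  have neg_zero: "- (0\<^sub>m m m) = (0\<^sub>m m m :: 'a mat)" by auto
  have add_neg: "A + - A = 0\<^sub>m n m" using A by auto
  note block_mult =
    mult_four_block_mat[where ?nr1.0 = n and ?n1.0 = n and ?n2.0 = m and ?nr2.0 = m]
  have PQ: "?P * ?Q = 1\<^sub>m (n + m)"
    by (subst block_mult) (use A nA neg_zero add_neg in auto)
  have QP: "?Q * ?P = 1\<^sub>m (n + m)"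
    by (subst block_mult) (use A nA neg_zero add_neg in auto)
  have PR: "?P * ?R = four_block_mat (A * B) (A * (B * A)) B (B * A)"
    by (subst block_mult) (use A B AB BA in auto)
  have LP: "?L * ?P = four_block_mat (A * B) (A * B * A) B (B * A)"
    by (subst block_mult) (use A B AB BA in auto)
  have "?P * ?R * ?Q = ?L * ?P * ?Q" unfolding PR LP using A B by simp
  also have "\<dots> = ?L"
    using PQ A B by (simp add: assoc_mult_mat[of _ "n+m" "n+m" _ "n+m" _ "n+m"])
  finally have "similar_mat ?L ?R"
    by (intro similar_matI[OF _ PQ QP]) (use A B in auto)
  from char_poly_similar[OF this] show ?thesis
    using A B by (simp add: char_poly_four_block_lower_triangular char_poly_zero_mat)
qed

lemma char_poly_2x2:
  "char_poly (mat 2 2 f :: 'a :: comm_ring_1 mat) =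
     [:f (0,0) * f (1,1) - f (0,1) * f (1,0), - (f (0,0) + f (1,1)), 1:]"
proof -
  let ?M = "char_poly_matrix (mat 2 2 f)"
  have "det ?M = (\<Sum>i<2. ?M $$ (i,0) * cofactor ?M i 0)"
    by (rule laplace_expansion_column[of _ 2]) simp_all
  moreover have "mat_delete ?M i 0 \<in> carrier_mat 1 1" for i
    by (simp add: mat_delete_def char_poly_matrix_def)
  ultimately show ?thesis
    by (simp add: char_poly_def cofactor_def det_single numeral_2_eq_2)
       (simp add: mat_delete_def char_poly_matrix_def algebra_simps)
qed

text \<open>
  The geometric sum treats \<open>r = 1\<close> and \<open>r \<noteq> 1\<close> uniformly; this absorbs the exceptional value
  \<open>q = -1\<close>, for which \<open>q\<^sup>2 = 1\<close>.
\<close>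

lemma qint_conv_sum: "qint (int n) r = (\<Sum>j<n. r ^ j)"
  by (simp add: qint_def geometric_sum)

theorem theorem1p4:
  fixes n :: nat and q t :: complex
  assumes "n \<ge> 2" and "q \<noteq> 0" and "q \<noteq> 1"
  shows "char_poly (mat n n (\<lambda>(j, k). q ^ (j + k) + t)) =
    monom 1 n
    - monom (of_nat n * t + qint (int n) (q\<^sup>2)) (n - 1)
    + monom ((of_nat n * qint (int n) (q\<^sup>2) - (qint (int n) q)\<^sup>2) * t) (n - 2)"
proof -
  let ?Q = "mat n n (\<lambda>(j, k). q ^ (j + k) + t)"
  let ?s = "qint (int n) q" and ?s2 = "qint (int n) (q\<^sup>2)"
  let ?a = "of_nat n * t + ?s2" and ?b = "(of_nat n * ?s2 - ?s\<^sup>2) * t"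
  define U where "U = mat n 2 (\<lambda>(j, i). if i = 0 then q ^ j else 1)"
  define V where "V = mat 2 n (\<lambda>(i, k). if i = 0 then q ^ k else t)"
  have U: "U \<in> carrier_mat n 2" and V: "V \<in> carrier_mat 2 n"
    by (simp_all add: U_def V_def)
  have UV: "U * V = ?Q"
    by (intro eq_matI)
       (auto simp: U_def V_def scalar_prod_def numeral_2_eq_2 power_add)
  have "V * U = mat 2 2 (\<lambda>(i, l). (\<Sum>k<n. V $$ (i, k) * U $$ (k, l)))"
    using U V by (intro eq_matI) (auto simp: scalar_prod_def lessThan_atLeast0)
  also have "char_poly \<dots> = [:?s2 * (of_nat n * t) - ?s * (t * ?s), - (?s2 + of_nat n * t), 1:]"
    by (simp add: char_poly_2x2 U_def V_def qint_conv_sum power2_eq_square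
        power_mult_distrib sum_distrib_left mult.commute)
  also have "\<dots> = monom 1 2 - monom ?a 1 + monom ?b 0"
    by (simp add: numeral_2_eq_2 monom_Suc monom_0 algebra_simps)
  finally have VU: "char_poly (V * U) = monom 1 2 - monom ?a 1 + monom ?b 0" .
  have "monom 1 2 * char_poly ?Q = monom 1 n * (monom 1 2 - monom ?a 1 + monom ?b 0)"
    using char_poly_mult_commute[OF U V] unfolding UV VU by (simp only: mult.commute)
  also have "\<dots> = monom 1 (n + 2) - monom ?a (n + 1) + monom ?b n"
    by (simp only: ring_distribs mult_monom) simp
  also have "\<dots> = monom 1 2 * (monom 1 n - monom ?a (n - 1) + monom ?b (n - 2))"
  proof -
    have shifts: "2 + n = n + 2" "2 + (n - 1) = n + 1" "2 + (n - 2) = n"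
      using \<open>n \<ge> 2\<close> by auto
    show ?thesis by (simp only: ring_distribs mult_monom shifts mult_1_left)
  qed
  finally show ?thesis by simp
qed

end
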